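(* Let $\Omega$ be a locally compact $\beta$-discrete groupoid on $B$ for which the target projection $\beta$ is an open map and whose base subgroupoid $\tilde B$ is paracompact. Assume that for any morphism $F:\Omega\to\mathbf{R}$ the continuity of $F$ on a neighborhood of $\tilde B$ implies the continuity of $F$ everywhere on $\Omega$. If for each $v\in B$ the orbit $[v]$ contains at least two elements, then $B$ is a discrete space.
   Context: A groupoid $\Omega$ on a base $B$ has source projection $\alpha:\Omega\to B$, target projection $\beta:\Omega\to B$, object inclusion map $u\mapsto\tilde u$ from $B$ to $\Omega$, and a partial multiplication $xy$ defined exactly when $(x,y)\in\Omega*\Omega=\{(x,y)\in\Omega\times\Omega:\alpha(x)=\beta(y)\}$, with $\alpha(xy)=\alpha(y)$, $\beta(xy)=\beta(x)$, associativity, $\alpha(\tilde u)=\beta(\tilde u)=u$, $x\widetilde{\alpha(x)}=x$, $\widetilde{\beta(x)}x=x$, and two-sided inverses: $\alpha(x^{-1})=\beta(x)$, $\beta(x^{-1})=\alpha(x)$, $x^{-1}x=\widetilde{\alpha(x)}$, $xx^{-1}=\widetilde{\beta(x)}$. The base subgroupoid is $\tilde B=\{\tilde u:u\in B\}\subseteq\Omega$. For $u,v\in B$, $\Omega_v^u=\beta^{-1}(\{u\})\cap\alpha^{-1}(\{v\})$. The relation $u\sim v$ iff $\Omega_v^u\neq\emptyset$ is an equivalence relation on $B$; its classes are the orbits, and $[v]$ denotes the orbit of $v$. A topological groupoid is a groupoid $\Omega$ on $B$ with topologies on $\Omega$ and $B$ such that $\alpha$, $\beta$, the object inclusion map, the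 inversion, and the partial multiplication (with $\Omega*\Omega$ carrying the subspace topology from $\Omega\times\Omega$) are continuous. A locally compact groupoid is a topological groupoid whose topology is locally compact Hausdorff. A locally compact groupoid is $\beta$-discrete if its base subgroupoid $\tilde B$ is an open subset of $\Omega$. A morphism $F:\Omega\to\mathbf{R}$ is a (not necessarily continuous) function into the additive group of real numbers with $F(xy)=F(x)+F(y)$ for every composable pair $(x,y)\in\Omega*\Omega$. *)

theory Defs
  imports "HOL-Analysis.Analysis"
begin

text \<open>
  The partial multiplication is a total function \<open>gmult\<close> that is only constrained on
  the composable pairs; likewise all other structure maps are only constrained on the
  carriers \<open>\<Omega>\<close> and \<open>B\<close>.
\<close>

definition composable :: "'a set \<Rightarrow> ('a \<Rightarrow> 'b) \<Rightarrow> ('a \<Rightarrow> 'b) \<Rightarrow> ('a \<times> 'a) set"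
  where "composable \<Omega> \<alpha> \<beta> = {(x, y) \<in> \<Omega> \<times> \<Omega>. \<alpha> x = \<beta> y}"

locale groupoid =
  fixes \<Omega> :: "'a set" and B :: "'b set"
    and \<alpha> \<beta> :: "'a \<Rightarrow> 'b"
    and gunit :: "'b \<Rightarrow> 'a"
    and gmult :: "'a \<Rightarrow> 'a \<Rightarrow> 'a"
    and ginv :: "'a \<Rightarrow> 'a"
  assumes source_closed: "x \<in> \<Omega> \<Longrightarrow> \<alpha> x \<in> B"
    and target_closed: "x \<in> \<Omega> \<Longrightarrow> \<beta> x \<in> B"
    and unit_closed: "u \<in> B \<Longrightarrow> gunit u \<in> \<Omega>"
    and mult_closed: "(x, y) \<in> composable \<Omega> \<alpha> \<beta> \<Longrightarrow> gmult x y \<in> \<Omega>"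
    and inv_closed: "x \<in> \<Omega> \<Longrightarrow> ginv x \<in> \<Omega>"
    and source_mult: "(x, y) \<in> composable \<Omega> \<alpha> \<beta> \<Longrightarrow> \<alpha> (gmult x y) = \<alpha> y"
    and target_mult: "(x, y) \<in> composable \<Omega> \<alpha> \<beta> \<Longrightarrow> \<beta> (gmult x y) = \<beta> x"
    and mult_assoc: "\<lbrakk>(x, y) \<in> composable \<Omega> \<alpha> \<beta>; (y, z) \<in> composable \<Omega> \<alpha> \<beta>\<rbrakk>
      \<Longrightarrow> gmult (gmult x y) z = gmult x (gmult y z)"
    and source_unit: "u \<in> B \<Longrightarrow> \<alpha> (gunit u) = u"
    and target_unit: "u \<in> B \<Longrightarrow> \<beta> (gunit u) = u"
    and mult_unit_right: "x \<in> \<Omega> \<Longrightarrow> gmult x (gunit (\<alpha> x)) = x"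
    and mult_unit_left: "x \<in> \<Omega> \<Longrightarrow> gmult (gunit (\<beta> x)) x = x"
    and source_inv: "x \<in> \<Omega> \<Longrightarrow> \<alpha> (ginv x) = \<beta> x"
    and target_inv: "x \<in> \<Omega> \<Longrightarrow> \<beta> (ginv x) = \<alpha> x"
    and mult_inv_left: "x \<in> \<Omega> \<Longrightarrow> gmult (ginv x) x = gunit (\<alpha> x)"
    and mult_inv_right: "x \<in> \<Omega> \<Longrightarrow> gmult x (ginv x) = gunit (\<beta> x)"

locale topological_groupoid =
  groupoid "topspace X" "topspace Y" \<alpha> \<beta> gunit gmult ginv
  for X :: "'a topology" and Y :: "'b topology" and \<alpha> \<beta> gunit gmult ginv +
  assumes continuous_source: "continuous_map X Y \<alpha>"
    and continuous_target: "continuous_map X Y \<beta>"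
    and continuous_unit: "continuous_map Y X gunit"
    and continuous_inv: "continuous_map X X ginv"
    and continuous_mult:
      "continuous_map (subtopology (prod_topology X X) (composable (topspace X) \<alpha> \<beta>)) X
        (\<lambda>(x, y). gmult x y)"

definition base_subgroupoid :: "'b set \<Rightarrow> ('b \<Rightarrow> 'a) \<Rightarrow> 'a set"
  where "base_subgroupoid B gunit = gunit ` B"

locale locally_compact_groupoid = topological_groupoid +
  assumes locally_compact: "locally_compact_space X"
    and Hausdorff: "Hausdorff_space X"

locale beta_discrete_groupoid = locally_compact_groupoid +
  assumes openin_base: "openin X (base_subgroupoid (topspace Y) gunit)"

definition hom_set :: "'a set \<Rightarrow> ('a \<Rightarrow> 'b) \<Rightarrow> ('a \<Rightarrow> 'b) \<Rightarrow> 'b \<Rightarrow> 'b \<Rightarrow> 'a set"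
  where "hom_set \<Omega> \<alpha> \<beta> u v = {x \<in> \<Omega>. \<beta> x = u \<and> \<alpha> x = v}"

definition orbit_rel :: "'a set \<Rightarrow> 'b set \<Rightarrow> ('a \<Rightarrow> 'b) \<Rightarrow> ('a \<Rightarrow> 'b) \<Rightarrow> ('b \<times> 'b) set"
  where "orbit_rel \<Omega> B \<alpha> \<beta> = {(u, v) \<in> B \<times> B. hom_set \<Omega> \<alpha> \<beta> u v \<noteq> {}}"

text \<open>In a groupoid \<open>orbit_rel\<close> is an equivalence relation, so its image at \<open>v\<close> is the class of \<open>v\<close>.\<close>

definition groupoid_orbit :: "'a set \<Rightarrow> 'b set \<Rightarrow> ('a \<Rightarrow> 'b) \<Rightarrow> ('a \<Rightarrow> 'b) \<Rightarrow> 'b \<Rightarrow> 'b set"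
  where "groupoid_orbit \<Omega> B \<alpha> \<beta> v = orbit_rel \<Omega> B \<alpha> \<beta> `` {v}"

lemma (in groupoid) equiv_orbit_rel: "equiv B (orbit_rel \<Omega> B \<alpha> \<beta>)"
proof (rule equivI)
  show "orbit_rel \<Omega> B \<alpha> \<beta> \<subseteq> B \<times> B"
    by (auto simp: orbit_rel_def)
  show "refl_on B (orbit_rel \<Omega> B \<alpha> \<beta>)"
    using unit_closed source_unit target_unit
    by (fastforce simp: refl_on_def orbit_rel_def hom_set_def)
  show "sym (orbit_rel \<Omega> B \<alpha> \<beta>)"
    using inv_closed source_inv target_inv
    by (fastforce simp: sym_def orbit_rel_def hom_set_def)
  show "trans (orbit_rel \<Omega> B \<alpha> \<beta>)"
  proof (rule transI)
    fix u v w
    assume "(u, v) \<in> orbit_rel \<Omega> B \<alpha> \<beta>" "(v, w) \<in> orbit_rel \<Omega> B \<alpha> \<beta>"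
    then obtain x y where xy: "x \<in> \<Omega>" "\<beta> x = u" "\<alpha> x = v" "y \<in> \<Omega>" "\<beta> y = v" "\<alpha> y = w"
      and uw: "u \<in> B" "w \<in> B"
      by (auto simp: orbit_rel_def hom_set_def)
    have "(x, y) \<in> composable \<Omega> \<alpha> \<beta>"
      using xy by (simp add: composable_def)
    then have "gmult x y \<in> hom_set \<Omega> \<alpha> \<beta> u w"
      using xy mult_closed source_mult target_mult by (simp add: hom_set_def)
    then show "(u, w) \<in> orbit_rel \<Omega> B \<alpha> \<beta>"
      using uw by (auto simp: orbit_rel_def)
  qed
qed

definition real_morphism ::
    "'a set \<Rightarrow> ('a \<Rightarrow> 'b) \<Rightarrow> ('a \<Rightarrow> 'b) \<Rightarrow> ('a \<Rightarrow> 'a \<Rightarrow> 'a) \<Rightarrow> ('a \<Rightarrow> real) \<Rightarrow> bool"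
  where "real_morphism \<Omega> \<alpha> \<beta> gmult F \<longleftrightarrow>
    (\<forall>(x, y) \<in> composable \<Omega> \<alpha> \<beta>. F (gmult x y) = F x + F y)"

definition neighbourhood_of_set :: "'a topology \<Rightarrow> 'a set \<Rightarrow> 'a set \<Rightarrow> bool"
  where "neighbourhood_of_set X S N \<longleftrightarrow>
    N \<subseteq> topspace X \<and> (\<exists>U. openin X U \<and> S \<subseteq> U \<and> U \<subseteq> N)"

text \<open>
  The Hausdorff property, which some authors include in paracompactness, is not part of
  this definition.
\<close>

definition paracompact_space :: "'a topology \<Rightarrow> bool"
  where "paracompact_space X \<longleftrightarrow>
    (\<forall>\<U>. (\<forall>U \<in> \<U>. openin X U) \<and> \<Union>\<U> = topspace X \<longrightarrow>
      (\<exists>\<V>. (\<forall>V \<in> \<V>. openin X V) \<and> \<Union>\<V> = topspace X \<and>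
        (\<forall>V \<in> \<V>. \<exists>U \<in> \<U>. V \<subseteq> U) \<and> locally_finite_in X \<V>))"

end

theory Submission
  imports Defs
begin

text \<open>
  Every function \<open>f\<close> on the base, however discontinuous, yields the coboundary
  \<open>x \<mapsto> f (\<beta> x) - f (\<alpha> x)\<close>, which is a morphism into the reals and vanishes on the base
  subgroupoid. As the base subgroupoid is open, it is a neighbourhood of itself, so the
  hypothesis on morphisms makes every coboundary continuous.

  Take for \<open>f\<close> the indicator of a point \<open>v\<close>. The orbit of \<open>v\<close> has a second point, so there
  is an arrow with target \<open>v\<close> and a different source, where the coboundary takes the value
  \<open>1\<close>. The arrows at which the coboundary is positive form an open set, nonempty by the
  choice of the arrow, and all of them have target \<open>v\<close>. Since \<open>\<beta>\<close> is open, the image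
  \<open>{v}\<close> of this set is open.
\<close>

definition coboundary :: "('a \<Rightarrow> 'b) \<Rightarrow> ('a \<Rightarrow> 'b) \<Rightarrow> ('b \<Rightarrow> real) \<Rightarrow> 'a \<Rightarrow> real"
  where "coboundary \<alpha> \<beta> f x = f (\<beta> x) - f (\<alpha> x)"

context groupoid
begin

lemma real_morphism_coboundary: "real_morphism \<Omega> \<alpha> \<beta> gmult (coboundary \<alpha> \<beta> f)"
  unfolding real_morphism_def
proof (clarify)
  fix x y
  assume xy: "(x, y) \<in> composable \<Omega> \<alpha> \<beta>"
  then have "\<alpha> x = \<beta> y"
    by (simp add: composable_def)
  then show "coboundary \<alpha> \<beta> f (gmult x y) = coboundary \<alpha> \<beta> f x + coboundary \<alpha> \<beta> f y"
    using source_mult[OF xy] target_mult[OF xy] by (simp add: coboundary_def)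
qed

lemma coboundary_eq_0_on_base:
  assumes "x \<in> base_subgroupoid B gunit"
  shows "coboundary \<alpha> \<beta> f x = 0"
  using assms source_unit target_unit by (auto simp: base_subgroupoid_def coboundary_def)

end

lemma (in beta_discrete_groupoid) coboundary_continuous_near_base:
  "\<exists>N. neighbourhood_of_set X (base_subgroupoid (topspace Y) gunit) N \<and>
    continuous_map (subtopology X N) euclideanreal (coboundary \<alpha> \<beta> f)"
proof (intro exI conjI)
  let ?N = "base_subgroupoid (topspace Y) gunit"
  show "neighbourhood_of_set X ?N ?N"
    unfolding neighbourhood_of_set_def
    using openin_base openin_subset by blast
  show "continuous_map (subtopology X ?N) euclideanreal (coboundary \<alpha> \<beta> f)"
    by (rule continuous_map_eq[where f = "\<lambda>_. 0"])
       (auto simp: coboundary_eq_0_on_base)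
qed

text \<open>
  Positivity matters: where the coboundary is merely nonzero, \<open>v\<close> could be the source
  rather than the target, and the target would be an arbitrary other point.
\<close>

lemma coboundary_indicator_pos_iff:
  "0 < coboundary \<alpha> \<beta> (indicator {v}) x \<longleftrightarrow> \<beta> x = v \<and> \<alpha> x \<noteq> v"
  by (auto simp: coboundary_def indicator_def)

lemma openin_target_singleton:
  assumes "open_map X Y \<beta>"
    and "continuous_map X euclideanreal (coboundary \<alpha> \<beta> (indicator {v}))"
    and "x \<in> topspace X" "\<beta> x = v" "\<alpha> x \<noteq> v"
  shows "openin Y {v}"
proof -
  let ?U = "{y \<in> topspace X. coboundary \<alpha> \<beta> (indicator {v}) y \<in> {0<..}}"
  have "openin X ?U"
    by (rule openin_continuous_map_preimage[OF assms(2)]) auto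
  then have "openin Y (\<beta> ` ?U)"
    using assms(1) by (simp add: open_map_def)
  moreover have "\<beta> ` ?U = {v}"
    using assms(3-5) by (auto simp: coboundary_indicator_pos_iff)
  ultimately show ?thesis
    by simp
qed

theorem corollary10:
  fixes X :: "'a topology" and Y :: "'b topology"
    and \<alpha> \<beta> :: "'a \<Rightarrow> 'b"
    and gunit :: "'b \<Rightarrow> 'a"
    and gmult :: "'a \<Rightarrow> 'a \<Rightarrow> 'a"
    and ginv :: "'a \<Rightarrow> 'a"
  assumes "beta_discrete_groupoid X Y \<alpha> \<beta> gunit gmult ginv"
    and "open_map X Y \<beta>"
    and "paracompact_space (subtopology X (base_subgroupoid (topspace Y) gunit))"
    and "\<forall>F. real_morphism (topspace X) \<alpha> \<beta> gmult F \<longrightarrow>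
      (\<exists>N. neighbourhood_of_set X (base_subgroupoid (topspace Y) gunit) N \<and>
        continuous_map (subtopology X N) euclideanreal F) \<longrightarrow>
      continuous_map X euclideanreal F"
    and "\<forall>v \<in> topspace Y.
      \<exists>u \<in> groupoid_orbit (topspace X) (topspace Y) \<alpha> \<beta> v.
      \<exists>w \<in> groupoid_orbit (topspace X) (topspace Y) \<alpha> \<beta> v. u \<noteq> w"
  shows "Y = discrete_topology (topspace Y)"
proof -
  interpret beta_discrete_groupoid X Y \<alpha> \<beta> gunit gmult ginv
    by (rule assms(1))
  have "openin Y {v}" if v: "v \<in> topspace Y" for v
  proof -
    obtain w where "w \<in> groupoid_orbit (topspace X) (topspace Y) \<alpha> \<beta> v" "w \<noteq> v"
      using assms(5) v by metis
    then obtain x where "x \<in> topspace X" "\<beta> x = v" "\<alpha> x \<noteq> v"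
      by (auto simp: groupoid_orbit_def orbit_rel_def hom_set_def)
    moreover have "continuous_map X euclideanreal (coboundary \<alpha> \<beta> (indicator {v}))"
      using assms(4) real_morphism_coboundary coboundary_continuous_near_base by blast
    ultimately show ?thesis
      using assms(2) openin_target_singleton by metis
  qed
  then show ?thesis
    by (metis discrete_topology_unique)
qed

end
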